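(* Let $\Omega=[0,1]$ be equipped with the Lebesgue measure. For every $\epsilon>0$ there exist two functions $f$ and $g$ on $\Omega$ such that $\|f-g\|_\infty\le\epsilon$, but $\|p_f-p_g\|_\infty\ge 1/2$, where $p_f$ and $p_g$ are the probability density functions induced by $f(\alpha)$ and $g(\alpha)$, respectively.
   Context: The PDF induced by a function $f:\Omega\to\mathbb{R}$ is the probability density on $\mathbb{R}$ of the random variable $f(\alpha)$, where $\alpha$ is distributed on $\Omega$ according to the given probability measure (here Lebesgue measure on $[0,1]$). $\|\cdot\|_\infty$ is the $L^\infty$ norm (on $\Omega$ for $f-g$, on $\mathbb{R}$ for densities). *)

theory Defs
  imports "HOL-Probability.Probability"
begin

(* The value is in ereal, since an essential supremum may be infinite. For non-measurable f
   esssup is infinite by convention. *)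
definition Linf_norm :: "'a measure \<Rightarrow> ('a \<Rightarrow> real) \<Rightarrow> ereal" where
  "Linf_norm M f = esssup M (\<lambda>x. ereal \<bar>f x\<bar>)"

(* p is a version of the density of f under M with respect to Lebesgue measure on the line;
   versions agree almost everywhere, so Linf_norm lborel does not depend on the choice.
   Nonnegativity is required separately because ennreal truncates negative reals to 0.
   Together with distributed it also makes p itself Borel measurable. *)
definition induced_pdf :: "'a measure \<Rightarrow> ('a \<Rightarrow> real) \<Rightarrow> (real \<Rightarrow> real) \<Rightarrow> bool" where
  "induced_pdf M f p \<longleftrightarrow>
     (\<forall>y. 0 \<le> p y) \<and> distributed M lborel f (\<lambda>y. ennreal (p y))"

end

(* Squeezing the uniform density on the unit interval into an interval of length d <= 1 makes it
   large there. So f x = d x and its translate g x = d x + d differ by only d, while their densities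
   have supports meeting in one point and height 1 / d >= 1. *)
theory Submission
  imports Defs
begin

lemma prob_space_lebesgue_on_unit: "prob_space (lebesgue_on {0..1::real})"
  by (rule prob_spaceI) (simp add: emeasure_restrict_space space_restrict_space)

text \<open>Both \<open>A\<close> and the test sets are Borel, and on Borel sets the completed
  measure agrees with \<open>lborel\<close>. Passing to Lebesgue sets on the source therefore does
  not change the law.\<close>

lemma distributed_ident_lebesgue_on:
  fixes A :: "real set"
  assumes A: "A \<in> sets borel"
  shows "distributed (lebesgue_on A) lborel (\<lambda>x. x) (indicator A)"
  unfolding distributed_def
proof (intro conjI)
  show ident: "(\<lambda>x. x) \<in> lebesgue_on A \<rightarrow>\<^sub>M lborel"
    by (intro measurable_restrict_space1 measurable_completion measurable_ident_sets) simp
  show "distr (lebesgue_on A) lborel (\<lambda>x. x) = density lborel (indicator A)"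
  proof (rule measure_eqI)
    fix B assume "B \<in> sets (distr (lebesgue_on A) lborel (\<lambda>x. x))"
    then have B: "B \<in> sets borel"
      by simp
    have "emeasure (distr (lebesgue_on A) lborel (\<lambda>x. x)) B = emeasure (lebesgue_on A) (A \<inter> B)"
      using B ident by (simp add: emeasure_distr space_restrict_space Int_commute)
    also have "\<dots> = emeasure lborel (A \<inter> B)"
      using A B by (simp add: emeasure_restrict_space emeasure_completion)
    also have "\<dots> = emeasure (density lborel (indicator A)) B"
      using A B by (simp add: emeasure_density indicator_inter_arith[symmetric])
    finally show "emeasure (distr (lebesgue_on A) lborel (\<lambda>x. x)) B =
      emeasure (density lborel (indicator A)) B" .
  qed simp
  show "indicator A \<in> borel_measurable lborel"
    using A by simp
qed

text \<open>Change of variables divides the uniform density at \<open>(y - t) / c\<close> by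
  \<open>c\<close>. Since \<open>c\<close> is positive, that point lies in \<open>{0..1}\<close>
  exactly when \<open>y\<close> lies in \<open>{t..t+c}\<close>.\<close>

lemma induced_pdf_affine:
  fixes c t :: real
  assumes c: "c > 0"
  shows "induced_pdf (lebesgue_on {0..1}) (\<lambda>x. t + c * x) (\<lambda>y. indicator {t..t+c} y / c)"
proof -
  interpret prob_space "lebesgue_on {0..1::real}"
    by (rule prob_space_lebesgue_on_unit)
  have "distributed (lebesgue_on {0..1}) lborel (\<lambda>x. t + c * x)
      (\<lambda>y. indicator {0..1} ((y - t) / c) / ennreal \<bar>c\<bar>)"
    using c by (intro distributed_affine distributed_ident_lebesgue_on) auto
  moreover have "indicator {0..1} ((y - t) / c) / ennreal \<bar>c\<bar> = ennreal (indicator {t..t+c} y / c)" for y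
    using c by (auto simp: indicator_def divide_ennreal[symmetric] field_simps)
  ultimately show ?thesis
    using c by (simp add: induced_pdf_def)
qed

text \<open>If the norm were below \<open>c\<close>, then \<bar>f\<bar> would be below
  \<open>c\<close> almost everywhere, which would make \<open>A\<close> null. For non-measurable
  \<open>f\<close> the norm is infinite, so the bound holds there too.\<close>

lemma Linf_norm_geI:
  assumes nonnull: "emeasure M A \<noteq> 0"
    and le: "\<And>x. x \<in> A \<Longrightarrow> c \<le> \<bar>f x\<bar>"
  shows "ereal c \<le> Linf_norm M f"
proof (rule ccontr)
  assume "\<not> ereal c \<le> Linf_norm M f"
  then have less: "Linf_norm M f < ereal c"
    by simp
  have "AE x in M. ereal \<bar>f x\<bar> \<le> Linf_norm M f"
    unfolding Linf_norm_def by (rule esssup_AE)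
  then have "AE x in M. x \<notin> A"
  proof eventually_elim
    case (elim x)
    then have "\<bar>f x\<bar> < c"
      using less by (metis ereal_less_eq(3) not_le order.trans)
    then show ?case
      using le by force
  qed
  \<comment> \<open>Sets outside the sigma-algebra have \<open>emeasure\<close> 0, so
    \<open>nonnull\<close> makes \<open>A\<close> measurable and the almost-everywhere statement
    says that \<open>A\<close> is null.\<close>
  then have "emeasure M A = 0"
    using nonnull emeasure_notin_sets
    by (metis AE_iff_null_sets null_setsD1)
  with nonnull show False ..
qed

theorem lemma4p2:
  fixes \<epsilon> :: real
  assumes "\<epsilon> > 0"
  shows "\<exists>(f :: real \<Rightarrow> real) (g :: real \<Rightarrow> real) (p\<^sub>f :: real \<Rightarrow> real) (p\<^sub>g :: real \<Rightarrow> real).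
           induced_pdf (lebesgue_on {0..1}) f p\<^sub>f \<and>
           induced_pdf (lebesgue_on {0..1}) g p\<^sub>g \<and>
           Linf_norm (lebesgue_on {0..1}) (\<lambda>\<alpha>. f \<alpha> - g \<alpha>) \<le> ereal \<epsilon> \<and>
           Linf_norm lborel (\<lambda>y. p\<^sub>f y - p\<^sub>g y) \<ge> ereal (1/2)"
proof -
  \<comment> \<open>The bound by \<epsilon> keeps the functions close; the bound by 1 makes the
    height \<open>1 / d\<close> at least 1.\<close>
  define d where "d = min \<epsilon> 1"
  have d: "0 < d" "d \<le> \<epsilon>" "d \<le> 1"
    using assms by (auto simp: d_def)
  \<comment> \<open>The summand 0 keeps \<open>?f\<close> and \<open>?p\<close> literal instances of
    \<open>induced_pdf_affine\<close> with \<open>t = 0\<close>.\<close>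
  let ?f = "\<lambda>x. 0 + d * x" and ?g = "\<lambda>x. d + d * x"
  let ?p = "\<lambda>y. indicator {0..0+d} y / d" and ?q = "\<lambda>y. indicator {d..d+d} y / d"
  have "Linf_norm (lebesgue_on {0..1}) (\<lambda>x. ?f x - ?g x) \<le> ereal \<epsilon>"
    unfolding Linf_norm_def using d by (intro esssup_I) auto
  moreover have "ereal (1/2) \<le> Linf_norm lborel (\<lambda>y. ?p y - ?q y)"
  proof (rule Linf_norm_geI)
    \<comment> \<open>On this interval only \<open>?p\<close> is nonzero; at the common endpoint
      \<open>d\<close> the two densities cancel.\<close>
    show "emeasure lborel {0<..<d} \<noteq> 0"
      using d by simp
    show "1/2 \<le> \<bar>?p y - ?q y\<bar>" if "y \<in> {0<..<d}" for y
      using that d by (simp add: indicator_def field_simps)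
  qed
  ultimately show ?thesis
    using induced_pdf_affine[OF d(1)] by blast
qed

end
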